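(* Let $\mathcal{H}$ be a separable complex Hilbert space and $d\in B(\mathcal{H})$. Then the following statements are equivalent: (a) the operator $d$ is quasidiagonal; (b) there exist an increasing sequence of finite rank projections $p_{1}\le p_{2}\le p_{3}\le\cdots$ on $\mathcal{H}$ and a sequence of Rota-Baxter operators $\{P_n\}$ of weight $-1$ on $B(\mathcal{H})$, such that $P_{n}$ matches $p_{n}$ on $B(\mathcal{H})$ for any $n\geq 1$, $p_{n}\to\mathrm{id}_{\mathcal{H}}$ in the strong operator topology as $n\to\infty$, and $\|P_{n}(b)-P_{n}(b^{\ast})^{\ast}\|\to 0$ as $n\to\infty$ for any $b\in C^{\ast}(d)$.
   Context: $B(\mathcal{H})$ is the $C^{\ast}$-algebra of bounded linear operators on $\mathcal{H}$, and $a.x$ denotes $a(x)$. A projection is $p\in B(\mathcal{H})$ with $p^2=p=p^{\ast}$; it is of finite rank if $p\mathcal{H}$ is finite dimensional; $p\le q$ means $q-p$ is positive. $[a,b]=ab-ba$. An operator $d\in B(\mathcal{H})$ is quasidiagonal if there exists an increasing sequence of finite rank projections $p_1\le p_2\le\cdots$ on $\mathcal{H}$ such that $\|[d,p_n]\|\to 0$ as $n\to\infty$ and $p_n\to\mathrm{id}_{\mathcal{H}}$ in the strong operator topology. $C^{\ast}(d)$ is the $C^{\ast}$-subalgebra of $B(\mathcal{H})$ generated by $d$, i.e. the norm closure of the (not necessarily unital) algebra generated by $d$ and $d^{\ast}$. A Rota-Baxter operator of weight $\lambda\in\mathbb{C}$ on $B(\mathcal{H})$ is a linear map $P:B(\mathcal{H})\to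 B(\mathcal{H})$ with $P(a)P(b)=P(aP(b))+P(P(a)b)+\lambda P(ab)$ for all $a,b$. For a linear operator $f$ on $\mathcal{H}$, it is said to match $f$ on $B(\mathcal{H})$ if $P(a).f(x)=f(P(a).x)+f(a.f(x))+\lambda f(a.x)$ for all $a\in B(\mathcal{H})$ and $x\in\mathcal{H}$. *)

theory Defs
  imports "HOL-Analysis.Analysis"
begin

section \<open>Complex Hilbert spaces\<close>

class complex_vector = real_vector +
  fixes scaleC :: "complex \<Rightarrow> 'a \<Rightarrow> 'a" (infixr \<open>*\<^sub>C\<close> 75)
  assumes scaleC_add_right: "c *\<^sub>C (x + y) = c *\<^sub>C x + c *\<^sub>C y"
    and scaleC_add_left: "(b + c) *\<^sub>C x = b *\<^sub>C x + c *\<^sub>C x"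
    and scaleC_scaleC: "b *\<^sub>C (c *\<^sub>C x) = (b * c) *\<^sub>C x"
    and scaleC_one: "1 *\<^sub>C x = x"
    and scaleR_scaleC: "r *\<^sub>R x = complex_of_real r *\<^sub>C x"

global_interpretation complex_vector: vector_space "scaleC :: complex \<Rightarrow> 'a \<Rightarrow> 'a::complex_vector"
  defines cspan = complex_vector.span
  by unfold_locales (simp_all add: scaleC_add_right scaleC_add_left scaleC_scaleC scaleC_one)

class complex_normed_vector = complex_vector + real_normed_vector +
  assumes norm_scaleC: "norm (c *\<^sub>C x) = cmod c * norm x"

text \<open>The inner product is linear in the second argument and conjugate linear in the first.\<close>

class complex_inner = complex_normed_vector +
  fixes cinner :: "'a \<Rightarrow> 'a \<Rightarrow> complex"
  assumes cinner_commute: "cinner x y = cnj (cinner y x)"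
    and cinner_add_right: "cinner x (y + z) = cinner x y + cinner x z"
    and cinner_scaleC_right: "cinner x (c *\<^sub>C y) = c * cinner x y"
    and cinner_ge_zero: "0 \<le> Re (cinner x x)"
    and cinner_eq_zero_iff: "cinner x x = 0 \<longleftrightarrow> x = 0"
    and norm_eq_sqrt_cinner: "norm x = sqrt (Re (cinner x x))"

class complex_hilbert_space = complex_inner + complete_space

instantiation complex :: complex_hilbert_space
begin

definition scaleC_complex :: "complex \<Rightarrow> complex \<Rightarrow> complex"
  where "scaleC_complex c x = c * x"

definition cinner_complex :: "complex \<Rightarrow> complex \<Rightarrow> complex"
  where "cinner_complex x y = cnj x * y"

instance
proof
  fix b c x y z :: complex and s :: real
  show "c *\<^sub>C (x + y) = c *\<^sub>C x + c *\<^sub>C y"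
    and "(b + c) *\<^sub>C x = b *\<^sub>C x + c *\<^sub>C x"
    and "b *\<^sub>C c *\<^sub>C x = (b * c) *\<^sub>C x"
    and "1 *\<^sub>C x = x"
    and "s *\<^sub>R x = complex_of_real s *\<^sub>C x"
    and "norm (c *\<^sub>C x) = cmod c * norm x"
    by (simp_all add: scaleC_complex_def ring_distribs norm_mult scaleR_conv_of_real)
  show "cinner x y = cnj (cinner y x)"
    and "cinner x (y + z) = cinner x y + cinner x z"
    and "cinner x (c *\<^sub>C y) = c * cinner x y"
    and "0 \<le> Re (cinner x x)"
    and "cinner x x = 0 \<longleftrightarrow> x = 0"
    by (simp_all add: cinner_complex_def scaleC_complex_def ring_distribs)
  show "norm x = sqrt (Re (cinner x x))"
    by (simp add: cinner_complex_def cmod_def power2_eq_square)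
qed

end


section \<open>Bounded operators\<close>

instantiation blinfun :: (real_normed_vector, complex_normed_vector) complex_normed_vector
begin

lift_definition scaleC_blinfun :: "complex \<Rightarrow> 'a \<Rightarrow>\<^sub>L 'b \<Rightarrow> 'a \<Rightarrow>\<^sub>L 'b"
  is "\<lambda>c f x. c *\<^sub>C f x"
proof -
  fix c :: complex and f :: "'a \<Rightarrow> 'b"
  assume "bounded_linear f"
  moreover have "bounded_linear (\<lambda>y::'b. c *\<^sub>C y)"
    by (rule bounded_linear_intro[where K = "cmod c"])
      (simp_all add: scaleC_add_right scaleR_scaleC scaleC_scaleC norm_scaleC mult.commute)
  ultimately show "bounded_linear (\<lambda>x. c *\<^sub>C f x)"
    by (rule bounded_linear_compose[rotated])
qed

instance
proof
  fix b c :: complex and r :: real and f g :: "'a \<Rightarrow>\<^sub>L 'b"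
  show "c *\<^sub>C (f + g) = c *\<^sub>C f + c *\<^sub>C g"
    by transfer (simp add: scaleC_add_right)
  show "(b + c) *\<^sub>C f = b *\<^sub>C f + c *\<^sub>C f"
    by transfer (simp add: scaleC_add_left)
  show "b *\<^sub>C c *\<^sub>C f = (b * c) *\<^sub>C f"
    by transfer (simp add: scaleC_scaleC)
  show "1 *\<^sub>C f = f"
    by transfer (simp add: scaleC_one)
  show "r *\<^sub>R f = complex_of_real r *\<^sub>C f"
    by transfer (simp add: scaleR_scaleC)
  have le: "norm (c *\<^sub>C f) \<le> cmod c * norm f" for c :: complex and f :: "'a \<Rightarrow>\<^sub>L 'b"
  proof (rule norm_blinfun_bound)
    show "norm (blinfun_apply (c *\<^sub>C f) x) \<le> cmod c * norm f * norm x" for x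
      using mult_left_mono[OF norm_blinfun[of f x], of "cmod c"]
      by (simp add: scaleC_blinfun.rep_eq norm_scaleC mult.assoc)
  qed simp
  show "norm (c *\<^sub>C f) = cmod c * norm f"
  proof (cases "c = 0")
    case True
    then show ?thesis using le[of 0 f] by simp
  next
    case False
    have "inverse c *\<^sub>C c *\<^sub>C f = f"
      by (rule blinfun_eqI) (simp add: scaleC_blinfun.rep_eq scaleC_scaleC scaleC_one False)
    then have "norm f \<le> inverse (cmod c) * norm (c *\<^sub>C f)"
      using le[of "inverse c" "c *\<^sub>C f"] by (simp add: norm_inverse)
    then have "cmod c * norm f \<le> norm (c *\<^sub>C f)"
      using False by (simp add: field_simps)
    with le[of c f] show ?thesis by simp
  qed
qed

end

text \<open>
  The type \<open>'h \<Rightarrow>\<^sub>L 'h\<close> consists of the bounded real-linear operators; \<open>B(H)\<close> is its closed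
  subalgebra of complex-linear ones, with product \<open>o\<^sub>L\<close> and the operator norm.
\<close>

definition bounded_ops :: "('h::complex_normed_vector \<Rightarrow>\<^sub>L 'h) set"
  where "bounded_ops = {a. Vector_Spaces.linear scaleC scaleC (blinfun_apply a)}"

text \<open>For \<open>a \<in> bounded_ops\<close> the description is proper, by the Riesz representation theorem.\<close>

definition adj :: "('h::complex_hilbert_space \<Rightarrow>\<^sub>L 'h) \<Rightarrow> ('h \<Rightarrow>\<^sub>L 'h)"
  where "adj a = (THE b. b \<in> bounded_ops \<and> (\<forall>x y. cinner (a x) y = cinner x (b y)))"

definition positive_op :: "('h::complex_hilbert_space \<Rightarrow>\<^sub>L 'h) \<Rightarrow> bool"
  where "positive_op a \<longleftrightarrow>
    a \<in> bounded_ops \<and> (\<forall>x. Im (cinner x (a x)) = 0 \<and> 0 \<le> Re (cinner x (a x)))"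

definition op_le :: "('h::complex_hilbert_space \<Rightarrow>\<^sub>L 'h) \<Rightarrow> ('h \<Rightarrow>\<^sub>L 'h) \<Rightarrow> bool"
  where "op_le a b \<longleftrightarrow> positive_op (b - a)"

definition projection :: "('h::complex_hilbert_space \<Rightarrow>\<^sub>L 'h) \<Rightarrow> bool"
  where "projection p \<longleftrightarrow> p \<in> bounded_ops \<and> p o\<^sub>L p = p \<and> adj p = p"

definition finite_rank :: "('h::complex_hilbert_space \<Rightarrow>\<^sub>L 'h) \<Rightarrow> bool"
  where "finite_rank a \<longleftrightarrow> (\<exists>B. finite B \<and> range (blinfun_apply a) = cspan B)"

definition incseq_finite_rank_projections :: "(nat \<Rightarrow> ('h::complex_hilbert_space \<Rightarrow>\<^sub>L 'h)) \<Rightarrow> bool"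
  where "incseq_finite_rank_projections p \<longleftrightarrow>
    (\<forall>n. projection (p n) \<and> finite_rank (p n) \<and> op_le (p n) (p (Suc n)))"

definition sot_tendsto :: "(nat \<Rightarrow> ('h::complex_hilbert_space \<Rightarrow>\<^sub>L 'h)) \<Rightarrow> ('h \<Rightarrow>\<^sub>L 'h) \<Rightarrow> bool"
  where "sot_tendsto a b \<longleftrightarrow> (\<forall>x. (\<lambda>n. blinfun_apply (a n) x) \<longlonglongrightarrow> blinfun_apply b x)"

definition commutator :: "('h::complex_hilbert_space \<Rightarrow>\<^sub>L 'h) \<Rightarrow> ('h \<Rightarrow>\<^sub>L 'h) \<Rightarrow> ('h \<Rightarrow>\<^sub>L 'h)"
  where "commutator a b = (a o\<^sub>L b) - (b o\<^sub>L a)"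

definition quasidiagonal :: "('h::complex_hilbert_space \<Rightarrow>\<^sub>L 'h) \<Rightarrow> bool"
  where "quasidiagonal d \<longleftrightarrow> d \<in> bounded_ops \<and>
    (\<exists>p. incseq_finite_rank_projections p \<and>
      (\<lambda>n. norm (commutator d (p n))) \<longlonglongrightarrow> 0 \<and> sot_tendsto p id_blinfun)"

inductive_set star_alg :: "('h::complex_hilbert_space \<Rightarrow>\<^sub>L 'h) \<Rightarrow> ('h \<Rightarrow>\<^sub>L 'h) set"
  for d where
    star_alg_gen: "d \<in> star_alg d"
  | star_alg_adj: "adj d \<in> star_alg d"
  | star_alg_add: "a \<in> star_alg d \<Longrightarrow> b \<in> star_alg d \<Longrightarrow> a + b \<in> star_alg d"
  | star_alg_scaleC: "a \<in> star_alg d \<Longrightarrow> c *\<^sub>C a \<in> star_alg d"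
  | star_alg_mult: "a \<in> star_alg d \<Longrightarrow> b \<in> star_alg d \<Longrightarrow> a o\<^sub>L b \<in> star_alg d"

definition cstar_alg :: "('h::complex_hilbert_space \<Rightarrow>\<^sub>L 'h) \<Rightarrow> ('h \<Rightarrow>\<^sub>L 'h) set"
  where "cstar_alg d = closure (star_alg d)"


section \<open>Rota-Baxter operators on \<open>B(H)\<close>\<close>

text \<open>
  A map on \<open>B(H)\<close> is a function on the type \<open>'h \<Rightarrow>\<^sub>L 'h\<close> that preserves \<open>bounded_ops\<close>; its values
  outside \<open>bounded_ops\<close> are irrelevant.
\<close>

definition rota_baxter ::
  "complex \<Rightarrow> (('h::complex_hilbert_space \<Rightarrow>\<^sub>L 'h) \<Rightarrow> ('h \<Rightarrow>\<^sub>L 'h)) \<Rightarrow> bool"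
  where "rota_baxter lam P \<longleftrightarrow>
    (\<forall>a\<in>bounded_ops. P a \<in> bounded_ops) \<and>
    (\<forall>a\<in>bounded_ops. \<forall>b\<in>bounded_ops. P (a + b) = P a + P b) \<and>
    (\<forall>c. \<forall>a\<in>bounded_ops. P (c *\<^sub>C a) = c *\<^sub>C P a) \<and>
    (\<forall>a\<in>bounded_ops. \<forall>b\<in>bounded_ops.
      P a o\<^sub>L P b = P (a o\<^sub>L P b) + P (P a o\<^sub>L b) + lam *\<^sub>C P (a o\<^sub>L b))"

definition matches ::
  "complex \<Rightarrow> (('h::complex_hilbert_space \<Rightarrow>\<^sub>L 'h) \<Rightarrow> ('h \<Rightarrow>\<^sub>L 'h)) \<Rightarrow> ('h \<Rightarrow> 'h) \<Rightarrow> bool"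
  where "matches lam P f \<longleftrightarrow>
    Vector_Spaces.linear scaleC scaleC f \<and>
    (\<forall>a\<in>bounded_ops. \<forall>x.
      blinfun_apply (P a) (f x) =
        f (blinfun_apply (P a) x) + f (blinfun_apply a (f x)) + lam *\<^sub>C f (blinfun_apply a x))"

end

theory Submission
  imports Defs
begin

text \<open>
  For a projection \<open>p\<close>, left multiplication \<open>P(a) = pa\<close> is a Rota-Baxter operator of weight \<open>-1\<close> that
  matches \<open>p\<close>, and \<open>P(b) - P(b*)* = pb - bp\<close>. So the asymptotic self-adjointness of these operators
  along a sequence \<open>p\<^sub>n\<close> is the statement that \<open>[b, p\<^sub>n] \<longlonglongrightarrow> 0\<close>. The operators \<open>b\<close> for which this
  holds form a norm closed algebra, which contains \<open>d*\<close> along with \<open>d\<close> because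
  \<open>[d*, p] = -[d, p]*\<close>; hence it contains \<open>C*(d)\<close> as soon as \<open>d\<close> is quasidiagonal with respect to
  the \<open>p\<^sub>n\<close>.

  In the converse direction the identity \<open>P(a)p = pP(a) + pap - pa\<close>, which says that \<open>P\<close> matches \<open>p\<close>,
  leaves the diagonal blocks of \<open>P(a)\<close> with respect to \<open>p\<close> free, but prescribes the others: the
  block \<open>(1-p)P(a)p\<close> vanishes and \<open>pP(a)(1-p) = pa(1-p)\<close>. The off-diagonal blocks of
  \<open>\<delta> = P(d) - P(d*)*\<close> are therefore \<open>pd(1-p)\<close> and \<open>-(1-p)dp\<close>, and \<open>[d, p]\<close> is minus their sum. Thus
  \<open>\<parallel>[d, p]\<parallel> \<le> 4\<parallel>\<delta>\<parallel>\<close> (lemma \<open>norm_commutator_le_if_matches\<close>).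

  Both directions calculate with adjoints of arbitrary bounded operators, whose existence rests on
  the Riesz representation theorem.
\<close>

section \<open>The inner product\<close>

lemma cinner_add_left: "cinner (x + y) z = cinner x z + cinner y (z::'a::complex_inner)"
  by (metis cinner_commute cinner_add_right complex_cnj_add)

lemma cinner_scaleC_left: "cinner (c *\<^sub>C x) y = cnj c * cinner x (y::'a::complex_inner)"
  by (metis cinner_commute cinner_scaleC_right complex_cnj_mult)

lemma cinner_scaleR_right: "cinner x (r *\<^sub>R y) = r * cinner x (y::'a::complex_inner)"
  by (simp add: scaleR_scaleC cinner_scaleC_right)

lemma cinner_scaleR_left: "cinner (r *\<^sub>R x) y = r * cinner x (y::'a::complex_inner)"
  by (simp add: scaleR_scaleC cinner_scaleC_left)

lemma cinner_minus_right: "cinner x (- y) = - cinner x (y::'a::complex_inner)"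
  using cinner_scaleR_right[of x "-1" y] by simp

lemma cinner_minus_left: "cinner (- x) y = - cinner x (y::'a::complex_inner)"
  using cinner_scaleR_left[of "-1" x y] by simp

lemma cinner_diff_right: "cinner x (y - z) = cinner x y - cinner x (z::'a::complex_inner)"
  using cinner_add_right[of x y "- z"] by (simp add: cinner_minus_right)

lemma cinner_diff_left: "cinner (x - y) z = cinner x z - cinner y (z::'a::complex_inner)"
  using cinner_add_left[of x "- y" z] by (simp add: cinner_minus_left)

lemma power2_norm_eq_cinner: "(norm (x::'a::complex_inner))\<^sup>2 = Re (cinner x x)"
  by (simp add: norm_eq_sqrt_cinner cinner_ge_zero)

lemma Re_cinner_commute: "Re (cinner x y) = Re (cinner y (x::'a::complex_inner))"
  by (metis cinner_commute complex_cnj_cnj cnj.simps(1))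

lemma power2_norm_add:
  "(norm (x + y))\<^sup>2 = (norm x)\<^sup>2 + 2 * Re (cinner x y) + (norm (y::'a::complex_inner))\<^sup>2"
  by (simp add: power2_norm_eq_cinner cinner_add_left cinner_add_right Re_cinner_commute[of y x])

text \<open>
  The triangle inequality is an axiom of the class, so this half of the Cauchy-Schwarz inequality
  comes from squaring it, instead of the other way round.
\<close>

lemma Re_cinner_le_norm: "Re (cinner x y) \<le> norm x * norm (y::'a::complex_inner)"
proof -
  have "(norm (x + y))\<^sup>2 \<le> (norm x + norm y)\<^sup>2"
    by (intro power_mono norm_triangle_ineq) simp
  then show ?thesis
    by (simp add: power2_norm_add power2_sum)
qed

lemma abs_Re_cinner_le_norm: "\<bar>Re (cinner x y)\<bar> \<le> norm x * norm (y::'a::complex_inner)"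
  using Re_cinner_le_norm[of x y] Re_cinner_le_norm[of x "- y"] by (simp add: cinner_minus_right)

lemma parallelogram_law:
  "(norm (x + y))\<^sup>2 + (norm (x - y))\<^sup>2 = 2 * (norm x)\<^sup>2 + 2 * (norm (y::'a::complex_inner))\<^sup>2"
  using power2_norm_add[of x y] power2_norm_add[of x "- y"]
  by (simp add: cinner_minus_right)

lemma cinner_ext_right:
  assumes "\<And>x. cinner x y = cinner x (z::'a::complex_inner)"
  shows "y = z"
  using assms[of "y - z"] cinner_eq_zero_iff[of "y - z"] by (simp add: cinner_diff_right)

lemma bounded_linear_scaleC: "bounded_linear (\<lambda>x::'a::complex_normed_vector. c *\<^sub>C x)"
  by (rule bounded_linear_intro[where K = "cmod c"])
    (simp_all add: scaleC_add_right scaleR_scaleC scaleC_scaleC norm_scaleC mult.commute)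


section \<open>The Riesz representation theorem and adjoints\<close>

text \<open>
  The representing vector is the minimum point of the quadratic functional
  \<open>J(x) = \<parallel>x\<parallel>\<^sup>2 - 2 f(x)\<close>. By the parallelogram law \<open>J\<close> is uniformly convex, so every minimizing
  sequence is a Cauchy sequence, and the derivative of \<open>J\<close> vanishes at the minimum point.
\<close>

lemma riesz_representation_Re:
  fixes f :: "'h::complex_hilbert_space \<Rightarrow> real"
  assumes f: "bounded_linear f"
  obtains u where "\<And>x. f x = Re (cinner u x)"
proof -
  interpret f: bounded_linear f by (rule f)
  define J where "J x = (norm x)\<^sup>2 - 2 * f x" for x
  obtain K where K: "\<bar>f x\<bar> \<le> norm x * K" for x
    using f.bounded by auto
  have J_ge: "- K\<^sup>2 \<le> J x" for x
  proof -
    have "0 \<le> (norm x - K)\<^sup>2" by simp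
    then show ?thesis using K[of x] unfolding J_def power2_diff by linarith
  qed
  define m where "m = Inf (range J)"
  have m_le: "m \<le> J x" for x
    unfolding m_def by (rule cInf_lower) (auto intro!: bdd_belowI[of _ "- K\<^sup>2"] J_ge)
  have convex: "(norm (x - y))\<^sup>2 = 2 * J x + 2 * J y - 4 * J ((1/2) *\<^sub>R (x + y))" for x y
  proof -
    have "4 * J ((1/2) *\<^sub>R (x + y)) = (norm (x + y))\<^sup>2 - 4 * f x - 4 * f y"
      by (simp add: J_def f.scaleR f.add power_divide add_divide_distrib
          del: scaleR_add_right)
    then show ?thesis using parallelogram_law[of x y] by (simp add: J_def)
  qed
  have "\<exists>x. J x < m + inverse (real (Suc n))" for n
    using cInf_lessD[of "range J" "m + inverse (real (Suc n))"] by (auto simp: m_def)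
  then obtain X where X: "\<And>n. J (X n) < m + inverse (real (Suc n))" by metis
  have J_X: "(\<lambda>n. J (X n)) \<longlonglongrightarrow> m"
  proof (rule tendsto_sandwich[OF _ _ tendsto_const])
    show "(\<lambda>n. m + inverse (real (Suc n))) \<longlonglongrightarrow> m"
      using tendsto_add[OF tendsto_const LIMSEQ_inverse_real_of_nat, of m] by simp
    show "\<forall>\<^sub>F n in sequentially. J (X n) \<le> m + inverse (real (Suc n))"
      using X by (intro always_eventually allI less_imp_le)
    show "\<forall>\<^sub>F n in sequentially. m \<le> J (X n)"
      using m_le by (intro always_eventually allI)
  qed
  have "Cauchy X"
  proof (rule metric_CauchyI)
    fix e :: real assume e: "0 < e"
    have "\<forall>\<^sub>F n in sequentially. J (X n) < m + e\<^sup>2 / 4"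
      using J_X by (rule order_tendstoD) (use e in simp)
    then obtain N where N: "\<And>n. N \<le> n \<Longrightarrow> J (X n) < m + e\<^sup>2 / 4"
      by (auto simp: eventually_sequentially)
    have "dist (X i) (X j) < e" if "N \<le> i" "N \<le> j" for i j
    proof -
      have "(norm (X i - X j))\<^sup>2 < e\<^sup>2"
        using N[OF that(1)] N[OF that(2)] m_le[of "(1/2) *\<^sub>R (X i + X j)"]
        by (simp add: convex)
      then show ?thesis using e by (simp add: dist_norm power_less_imp_less_base)
    qed
    then show "\<exists>M. \<forall>i\<ge>M. \<forall>j\<ge>M. dist (X i) (X j) < e" by blast
  qed
  then obtain u where u: "X \<longlonglongrightarrow> u"
    using Cauchy_convergent convergent_def by blast
  have "(\<lambda>n. J (X n)) \<longlonglongrightarrow> J u"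
    unfolding J_def by (intro tendsto_intros u f.tendsto)
  with J_X have J_u: "J u = m" by (rule LIMSEQ_unique[symmetric])
  have "f x = Re (cinner u x)" for x
  proof -
    define D where "D = 2 * (Re (cinner u x) - f x)"
    have quad: "0 \<le> t * D + t\<^sup>2 * (norm x)\<^sup>2" for t :: real
    proof -
      have "J (u + t *\<^sub>R x) = J u + t * D + t\<^sup>2 * (norm x)\<^sup>2"
        by (simp add: J_def D_def power2_norm_add cinner_scaleR_right f.add f.scaleR
            power_mult_distrib algebra_simps)
      with m_le[of "u + t *\<^sub>R x"] J_u show ?thesis by simp
    qed
    (* This value of t makes the linear term -s D^2 outweigh the quadratic one, as
       s |x|^2 < 1. *)
    define s where "s = inverse (1 + (norm x)\<^sup>2)"
    have s: "0 < s" by (simp add: s_def add_pos_nonneg)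
    have "s * (1 + (norm x)\<^sup>2) = 1"
      unfolding s_def by (rule left_inverse) (smt (verit) zero_le_power2)
    then have "s * (norm x)\<^sup>2 = 1 - s" by (simp add: algebra_simps)
    then have "(- s * D) * D + (- s * D)\<^sup>2 * (norm x)\<^sup>2 = - (s\<^sup>2 * D\<^sup>2)"
      by algebra
    with quad[of "- s * D"] have "s\<^sup>2 * D\<^sup>2 \<le> 0" by simp
    with s have "D = 0" by (smt (verit) mult_pos_pos zero_less_power2)
    then show ?thesis by (simp add: D_def)
  qed
  with that show thesis by blast
qed

text \<open>
  The imaginary part of a complex linear functional is determined by its real part:
  \<open>Im g(x) = -Re g(\<i>x)\<close>.
\<close>

lemma riesz_representation:
  fixes g :: "'h::complex_hilbert_space \<Rightarrow> complex"
  assumes bounded: "bounded_linear (\<lambda>x. Re (g x))" and lin: "\<And>c x. g (c *\<^sub>C x) = c * g x"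
  obtains u where "\<And>x. g x = cinner u x"
proof -
  obtain u where u: "\<And>x. Re (g x) = Re (cinner u x)"
    using riesz_representation_Re[OF bounded] by blast
  have "g x = cinner u x" for x
    using u[of x] u[of "\<i> *\<^sub>C x"] by (simp add: lin cinner_scaleC_right complex_eq_iff)
  with that show thesis by blast
qed

lemma bounded_ops_iff:
  "a \<in> bounded_ops \<longleftrightarrow> (\<forall>c x. blinfun_apply a (c *\<^sub>C x) = c *\<^sub>C blinfun_apply a x)"
proof
  assume "a \<in> bounded_ops"
  then interpret Vector_Spaces.linear scaleC scaleC "blinfun_apply a"
    by (simp add: bounded_ops_def)
  show "\<forall>c x. blinfun_apply a (c *\<^sub>C x) = c *\<^sub>C blinfun_apply a x" by (simp add: scale)
next
  assume "\<forall>c x. blinfun_apply a (c *\<^sub>C x) = c *\<^sub>C blinfun_apply a x"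
  then show "a \<in> bounded_ops"
    unfolding bounded_ops_def
    by (auto intro!: Vector_Spaces.linear.intro complex_vector.vector_space_axioms
        module_hom.intro module_hom_axioms.intro complex_vector.module_axioms
        simp: blinfun.add_right)
qed

lemma bounded_ops_compose: "a \<in> bounded_ops \<Longrightarrow> b \<in> bounded_ops \<Longrightarrow> a o\<^sub>L b \<in> bounded_ops"
  by (simp add: bounded_ops_iff)

lemma blinfun_compose_assoc: "(a o\<^sub>L b) o\<^sub>L c = a o\<^sub>L (b o\<^sub>L c)"
  by (rule blinfun_eqI) simp

lemma bounded_ops_add: "a \<in> bounded_ops \<Longrightarrow> b \<in> bounded_ops \<Longrightarrow> a + b \<in> bounded_ops"
  by (simp add: bounded_ops_iff blinfun.add_left scaleC_add_right)

lemma bounded_ops_diff: "a \<in> bounded_ops \<Longrightarrow> b \<in> bounded_ops \<Longrightarrow> a - b \<in> bounded_ops"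
  by (simp add: bounded_ops_iff blinfun.diff_left complex_vector.scale_right_diff_distrib)

lemma bounded_ops_scaleC: "a \<in> bounded_ops \<Longrightarrow> c *\<^sub>C a \<in> bounded_ops"
  by (simp add: bounded_ops_iff scaleC_blinfun.rep_eq scaleC_scaleC mult.commute)

lemma closed_bounded_ops: "closed (bounded_ops :: ('h::complex_normed_vector \<Rightarrow>\<^sub>L 'h) set)"
proof -
  have "bounded_ops = {a :: 'h \<Rightarrow>\<^sub>L 'h. \<forall>c x. a (c *\<^sub>C x) = c *\<^sub>C a x}"
    by (auto simp: bounded_ops_iff)
  also have "closed \<dots>"
    by (intro closed_Collect_all closed_Collect_eq continuous_intros
        bounded_linear.continuous_on[OF bounded_linear_scaleC])
  finally show ?thesis .
qed

lemma adjoint_exists: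
  fixes a :: "'h::complex_hilbert_space \<Rightarrow>\<^sub>L 'h"
  assumes a: "a \<in> bounded_ops"
  obtains b where "b \<in> bounded_ops" "\<And>x y. cinner (a x) y = cinner x (b y)"
proof -
  have "\<exists>u. \<forall>x. cinner y (a x) = cinner u x" for y
  proof -
    have "bounded_linear (\<lambda>x. Re (cinner y (a x)))"
    proof (rule bounded_linear_intro)
      fix x
      have "norm (Re (cinner y (a x))) \<le> norm y * norm (a x)"
        using abs_Re_cinner_le_norm by simp
      also have "\<dots> \<le> norm y * (norm a * norm x)"
        by (intro mult_left_mono norm_blinfun) simp
      finally show "norm (Re (cinner y (a x))) \<le> norm x * (norm y * norm a)"
        by (simp add: ac_simps)
    qed (simp_all add: blinfun.add_right blinfun.scaleR_right cinner_add_right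
        cinner_scaleR_right)
    moreover have "cinner y (a (c *\<^sub>C x)) = c * cinner y (a x)" for c x
      using a by (simp add: bounded_ops_iff cinner_scaleC_right)
    ultimately obtain u where "\<And>x. cinner y (a x) = cinner u x"
      using riesz_representation[of "\<lambda>x. cinner y (a x)"] by blast
    then show ?thesis by blast
  qed
  then obtain B where B': "\<And>x y. cinner y (a x) = cinner (B y) x" by metis
  have B: "cinner (a x) y = cinner x (B y)" for x y
    by (metis B' cinner_commute)
  have B_scaleC: "B (c *\<^sub>C y) = c *\<^sub>C B y" for c y
    by (rule cinner_ext_right) (simp add: B[symmetric] cinner_scaleC_right)
  have "bounded_linear B"
  proof (rule bounded_linear_intro)
    show "B (x + y) = B x + B y" for x y
      by (rule cinner_ext_right) (simp add: B[symmetric] cinner_add_right)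
    show "B (r *\<^sub>R x) = r *\<^sub>R B x" for r x
      by (simp add: scaleR_scaleC B_scaleC)
    show "norm (B y) \<le> norm y * norm a" for y
    proof (cases "B y = 0")
      case False
      have "(norm (B y))\<^sup>2 = Re (cinner (a (B y)) y)" by (simp add: power2_norm_eq_cinner B)
      also have "\<dots> \<le> norm (a (B y)) * norm y" by (rule Re_cinner_le_norm)
      also have "\<dots> \<le> (norm a * norm (B y)) * norm y"
        by (intro mult_right_mono norm_blinfun) simp
      finally show ?thesis using False by (simp add: power2_eq_square ac_simps)
    qed simp
  qed
  then have "blinfun_apply (Blinfun B) = B" by (rule bounded_linear_Blinfun_apply)
  then show thesis using that[of "Blinfun B"] by (simp add: bounded_ops_iff B_scaleC B)
qed

lemma adj_unique:
  assumes "b \<in> bounded_ops" "\<And>x y. cinner (blinfun_apply a x) y = cinner x (blinfun_apply b y)"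
  shows "adj a = b"
  unfolding adj_def
proof (rule the_equality)
  fix b' assume "b' \<in> bounded_ops \<and>
    (\<forall>x y. cinner (blinfun_apply a x) y = cinner x (blinfun_apply b' y))"
  then show "b' = b" using assms by (metis blinfun_eqI cinner_ext_right)
qed (use assms in simp)

lemma
  assumes "a \<in> bounded_ops"
  shows adj_bounded_ops: "adj a \<in> bounded_ops"
    and cinner_adj_right: "cinner x (blinfun_apply (adj a) y) = cinner (blinfun_apply a x) y"
proof -
  obtain b where b: "b \<in> bounded_ops" "\<And>x y. cinner (blinfun_apply a x) y = cinner x (blinfun_apply b y)"
    using adjoint_exists[OF assms] by blast
  then show "adj a \<in> bounded_ops"
    and "cinner x (blinfun_apply (adj a) y) = cinner (blinfun_apply a x) y"
    using adj_unique[OF b] by simp_all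
qed

lemma cinner_adj_left:
  "a \<in> bounded_ops \<Longrightarrow> cinner (blinfun_apply (adj a) x) y = cinner x (blinfun_apply a y)"
  by (metis cinner_adj_right cinner_commute)

lemma adj_adj: "a \<in> bounded_ops \<Longrightarrow> adj (adj a) = a"
  by (rule adj_unique) (simp_all add: cinner_adj_left)

lemma adj_compose: "a \<in> bounded_ops \<Longrightarrow> b \<in> bounded_ops \<Longrightarrow> adj (a o\<^sub>L b) = adj b o\<^sub>L adj a"
  by (rule adj_unique) (simp_all add: bounded_ops_compose adj_bounded_ops cinner_adj_right)

lemma norm_adj_le:
  assumes a: "a \<in> bounded_ops"
  shows "norm (adj a) \<le> norm a"
proof (rule norm_blinfun_bound)
  fix y
  show "norm (adj a y) \<le> norm a * norm y"
  proof (cases "adj a y = 0")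
    case False
    have "(norm (adj a y))\<^sup>2 = Re (cinner (a (adj a y)) y)"
      by (simp add: power2_norm_eq_cinner cinner_adj_right a)
    also have "\<dots> \<le> norm (a (adj a y)) * norm y" by (rule Re_cinner_le_norm)
    also have "\<dots> \<le> (norm a * norm (adj a y)) * norm y"
      by (intro mult_right_mono norm_blinfun) simp
    finally show ?thesis using False by (simp add: power2_eq_square ac_simps)
  qed simp
qed simp


section \<open>Commutators with projections\<close>

lemma norm_projection_le_1:
  assumes p: "projection p"
  shows "norm p \<le> 1"
proof (rule norm_blinfun_bound)
  fix x
  show "norm (p x) \<le> 1 * norm x"
  proof (cases "p x = 0")
    case False
    have "cinner (p x) (p x) = cinner x (p x)"
      using p unfolding projection_def
      by (metis cinner_adj_right blinfun_apply_blinfun_compose)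
    then have "(norm (p x))\<^sup>2 \<le> norm x * norm (p x)"
      by (simp add: power2_norm_eq_cinner Re_cinner_le_norm)
    then show ?thesis using False by (simp add: power2_eq_square)
  qed simp
qed simp

lemma norm_compose_le_contraction:
  fixes a p :: "'h::real_normed_vector \<Rightarrow>\<^sub>L 'h"
  assumes "norm p \<le> 1"
  shows norm_compose_left_contraction_le: "norm (p o\<^sub>L a) \<le> norm a"
    and norm_compose_right_contraction_le: "norm (a o\<^sub>L p) \<le> norm a"
  using norm_blinfun_compose[of p a] norm_blinfun_compose[of a p]
    mult_right_mono[OF assms norm_ge_zero[of a]] mult_left_mono[OF assms norm_ge_zero[of a]]
  by simp_all

lemma adj_diff:
  "a \<in> bounded_ops \<Longrightarrow> b \<in> bounded_ops \<Longrightarrow> adj (a - b) = adj a - adj b"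
  by (rule adj_unique) (simp_all add: adj_bounded_ops bounded_ops_diff cinner_adj_right
      blinfun.diff_left cinner_diff_left cinner_diff_right)

text \<open>Taking adjoints is isometric and, for self-adjoint \<open>p\<close>, turns \<open>[b, p]\<close> into \<open>-[b*, p]\<close>.\<close>

lemma norm_commutator_adj_le:
  assumes p: "projection p" and b: "b \<in> bounded_ops"
  shows "norm (commutator (adj b) p) \<le> norm (commutator b p)"
proof -
  have p': "p \<in> bounded_ops" "adj p = p" using p by (simp_all add: projection_def)
  have "commutator (adj b) p = - adj (commutator b p)"
    using b p' by (simp add: commutator_def adj_diff adj_compose bounded_ops_compose)
  moreover have "commutator b p \<in> bounded_ops"
    using b p' by (simp add: commutator_def bounded_ops_diff bounded_ops_compose)
  ultimately show ?thesis by (simp add: norm_adj_le)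
qed

lemma star_alg_subset_bounded_ops:
  assumes "d \<in> bounded_ops" and "b \<in> star_alg d"
  shows "b \<in> bounded_ops"
  using assms(2)
  by induction (simp_all add: assms(1) adj_bounded_ops bounded_ops_add bounded_ops_scaleC
      bounded_ops_compose)

lemma cstar_alg_subset_bounded_ops:
  assumes "d \<in> bounded_ops"
  shows "cstar_alg d \<subseteq> bounded_ops"
  unfolding cstar_alg_def
  using star_alg_subset_bounded_ops[OF assms] closed_bounded_ops by (intro closure_minimal) auto

lemma commutator_star_alg_tendsto_0:
  assumes p: "\<And>n. projection (p n)" and d: "d \<in> bounded_ops"
    and lim: "(\<lambda>n. norm (commutator d (p n))) \<longlonglongrightarrow> 0"
    and b: "b \<in> star_alg d"
  shows "(\<lambda>n. commutator b (p n)) \<longlonglongrightarrow> 0"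
  using b
proof induction
  case star_alg_gen
  show ?case using lim by (rule tendsto_norm_zero_cancel)
next
  case star_alg_adj
  show ?case
    by (rule Lim_null_comparison[OF _ lim]) (simp add: norm_commutator_adj_le p d)
next
  case (star_alg_add a b)
  have "commutator (a + b) (p n) = commutator a (p n) + commutator b (p n)" for n
    by (rule blinfun_eqI) (simp add: commutator_def blinfun.bilinear_simps)
  with tendsto_add[OF star_alg_add.IH] show ?case by simp
next
  case (star_alg_scaleC a c)
  have "p n \<in> bounded_ops" for n using p by (simp add: projection_def)
  then have "commutator (c *\<^sub>C a) (p n) = c *\<^sub>C commutator a (p n)" for n
    by (intro blinfun_eqI) (simp add: commutator_def blinfun.bilinear_simps scaleC_blinfun.rep_eq
        bounded_ops_iff complex_vector.scale_right_diff_distrib)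
  with bounded_linear.tendsto_zero[OF bounded_linear_scaleC star_alg_scaleC.IH]
  show ?case by simp
next
  case (star_alg_mult a b)
  have "commutator (a o\<^sub>L b) (p n) = (a o\<^sub>L commutator b (p n)) + (commutator a (p n) o\<^sub>L b)" for n
    by (rule blinfun_eqI) (simp add: commutator_def blinfun.bilinear_simps)
  moreover have "(\<lambda>n. (a o\<^sub>L commutator b (p n)) + (commutator a (p n) o\<^sub>L b)) \<longlonglongrightarrow> (a o\<^sub>L 0) + (0 o\<^sub>L b)"
    by (intro tendsto_add bounded_bilinear.tendsto[OF bounded_bilinear_blinfun_compose]
        tendsto_const star_alg_mult.IH)
  ultimately show ?case by simp
qed

text \<open>
  The maps \<open>b \<mapsto> [b, p\<^sub>n]\<close> have norm at most \<open>2\<close> for every \<open>n\<close>; this uniform bound carries the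
  convergence over to the norm closure.
\<close>

lemma commutator_cstar_alg_tendsto_0:
  assumes p: "\<And>n. projection (p n)" and d: "d \<in> bounded_ops"
    and lim: "(\<lambda>n. norm (commutator d (p n))) \<longlonglongrightarrow> 0"
    and b: "b \<in> cstar_alg d"
  shows "(\<lambda>n. norm (commutator b (p n))) \<longlonglongrightarrow> 0"
proof (rule tendsto_norm_zero, rule tendstoI)
  fix e :: real assume e: "0 < e"
  then obtain b' where b': "b' \<in> star_alg d" "dist b' b < e / 4"
    using b unfolding cstar_alg_def closure_approachable by (metis divide_pos_pos zero_less_numeral)
  have "\<forall>\<^sub>F n in sequentially. dist (commutator b' (p n)) 0 < e / 2"
    using commutator_star_alg_tendsto_0[OF p d lim b'(1)] by (rule tendstoD) (use e in simp)
  then show "\<forall>\<^sub>F n in sequentially. dist (commutator b (p n)) 0 < e"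
  proof eventually_elim
    case (elim n)
    define c where "c = b - b'"
    have "norm (p n) \<le> 1" using p by (rule norm_projection_le_1)
    then have "norm (commutator c (p n)) \<le> norm c + norm c"
      unfolding commutator_def
      by (intro norm_triangle_le_diff add_mono norm_compose_le_contraction)
    moreover have "norm c < e / 4" using b'(2) by (simp add: c_def dist_norm norm_minus_commute)
    moreover have "commutator b (p n) = commutator b' (p n) + commutator c (p n)"
      by (rule blinfun_eqI) (simp add: commutator_def c_def blinfun.bilinear_simps)
    ultimately show ?case
      using elim norm_triangle_ineq[of "commutator b' (p n)" "commutator c (p n)"] by simp
  qed
qed


section \<open>Rota-Baxter operators matching a projection\<close>

lemma rota_baxter_left_mult:
  assumes p: "projection p"
  shows "rota_baxter (-1) (\<lambda>a. p o\<^sub>L a)"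
proof -
  have p': "p \<in> bounded_ops" "p (p x) = p x" for x
    using p by (auto simp: projection_def simp flip: blinfun_apply_blinfun_compose)
  then show ?thesis
    unfolding rota_baxter_def
    by (auto intro!: blinfun_eqI bounded_ops_compose
        simp: blinfun.bilinear_simps scaleC_blinfun.rep_eq bounded_ops_iff)
qed

lemma matches_left_mult:
  assumes p: "projection p"
  shows "matches (-1) (\<lambda>a. p o\<^sub>L a) (blinfun_apply p)"
proof -
  have "p (p x) = p x" for x
    using p by (auto simp: projection_def simp flip: blinfun_apply_blinfun_compose)
  then show ?thesis
    using p by (simp add: matches_def projection_def bounded_ops_def)
qed

text \<open>
  The right-hand side of \<open>P(a)p = pP(a) + pap - pa\<close> is fixed by left multiplication with \<open>p\<close>, so the
  left-hand side is as well: the lower left block of \<open>P(a)\<close> is zero. With \<open>P(a)p\<close> replaced by \<open>pP(a)p\<close>,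
  the identity says that the upper right blocks of \<open>P(a)\<close> and \<open>a\<close> agree.
\<close>

lemma matches_off_diagonal:
  assumes p: "projection p" and P: "matches (-1) P (blinfun_apply p)" and a: "a \<in> bounded_ops"
  shows matches_lower_block: "P a o\<^sub>L p = p o\<^sub>L P a o\<^sub>L p"
    and matches_upper_block: "(p o\<^sub>L a) - (p o\<^sub>L a o\<^sub>L p) = (p o\<^sub>L P a) - (p o\<^sub>L P a o\<^sub>L p)"
proof -
  have idem: "p (p x) = p x" for x
    using p by (auto simp: projection_def simp flip: blinfun_apply_blinfun_compose)
  have m: "P a (p x) = p (P a x) + p (a (p x)) - p (a x)" for x
    using P a by (simp add: matches_def)
  have lower: "p (P a (p x)) = P a (p x)" for x
    by (simp add: m blinfun.bilinear_simps idem)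
  then show "P a o\<^sub>L p = p o\<^sub>L P a o\<^sub>L p"
    by (intro blinfun_eqI) simp
  show "(p o\<^sub>L a) - (p o\<^sub>L a o\<^sub>L p) = (p o\<^sub>L P a) - (p o\<^sub>L P a o\<^sub>L p)"
    by (rule blinfun_eqI) (simp add: blinfun.diff_left lower, simp add: m)
qed

lemma norm_commutator_le_if_matches:
  assumes p: "projection p" and P: "matches (-1) P (blinfun_apply p)"
    and P_ops: "\<And>a. a \<in> bounded_ops \<Longrightarrow> P a \<in> bounded_ops" and d: "d \<in> bounded_ops"
  shows "norm (commutator d p) \<le> 4 * norm (P d - adj (P (adj d)))"
proof -
  define \<delta> where "\<delta> = P d - adj (P (adj d))"
  define e where "e = P (adj d)"
  have p': "p \<in> bounded_ops" "adj p = p" using p by (simp_all add: projection_def)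
  have d': "adj d \<in> bounded_ops" using d by (rule adj_bounded_ops)
  have e: "e \<in> bounded_ops" using P_ops[OF d'] by (simp add: e_def)
  \<comment> \<open>Adjoining swaps the off-diagonal blocks: the upper right block of \<open>e*\<close> is zero, and its lower
    left block is that of \<open>d\<close>.\<close>
  have adj_lower: "p o\<^sub>L adj e = p o\<^sub>L adj e o\<^sub>L p"
    using arg_cong[OF matches_lower_block[OF p P d'], of adj]
    by (simp (no_asm_use) add: e p' adj_compose bounded_ops_compose e_def[symmetric]
        blinfun_compose_assoc)
  have adj_upper: "(d o\<^sub>L p) - (p o\<^sub>L d o\<^sub>L p) = (adj e o\<^sub>L p) - (p o\<^sub>L adj e o\<^sub>L p)"
    using arg_cong[OF matches_upper_block[OF p P d'], of adj] e p' d d'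
    by (simp add: adj_compose adj_diff adj_adj bounded_ops_compose e_def[symmetric]
        blinfun_compose_assoc)
  note lower = matches_lower_block[OF p P d] and upper = matches_upper_block[OF p P d]
  \<comment> \<open>The right-hand side is minus the sum of the off-diagonal blocks of \<open>\<delta>\<close>.\<close>
  have "commutator d p = 2 *\<^sub>R (p o\<^sub>L \<delta> o\<^sub>L p) - (\<delta> o\<^sub>L p) - (p o\<^sub>L \<delta>)"
  proof (rule blinfun_eqI)
    fix x
    note [simp] = blinfun.bilinear_simps
    have "P d (p x) = p (P d (p x))" "p (adj e x) = p (adj e (p x))"
      "d (p x) - p (d (p x)) = adj e (p x) - p (adj e (p x))"
      "p (d x) - p (d (p x)) = p (P d x) - p (P d (p x))"
      using arg_cong[OF lower, of "\<lambda>a. blinfun_apply a x"]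
        arg_cong[OF adj_lower, of "\<lambda>a. blinfun_apply a x"]
        arg_cong[OF adj_upper, of "\<lambda>a. blinfun_apply a x"]
        arg_cong[OF upper, of "\<lambda>a. blinfun_apply a x"] by simp_all
    then show "commutator d p x = (2 *\<^sub>R (p o\<^sub>L \<delta> o\<^sub>L p) - (\<delta> o\<^sub>L p) - (p o\<^sub>L \<delta>)) x"
      by (simp add: commutator_def \<delta>_def e_def[symmetric] scaleR_2 algebra_simps)
  qed
  also have "norm \<dots> \<le> 2 * norm (p o\<^sub>L \<delta> o\<^sub>L p) + norm (\<delta> o\<^sub>L p) + norm (p o\<^sub>L \<delta>)"
    by (intro norm_triangle_le_diff add_right_mono) simp
  also have "\<dots> \<le> 4 * norm \<delta>"
  proof -
    note le = norm_compose_le_contraction[OF norm_projection_le_1[OF p]]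
    show ?thesis using le(1)[of \<delta>] le(2)[of \<delta>] le(2)[of "p o\<^sub>L \<delta>"] by linarith
  qed
  finally show ?thesis by (simp add: \<delta>_def)
qed

theorem proposition4p4:
  fixes d :: "'h::complex_hilbert_space \<Rightarrow>\<^sub>L 'h"
  assumes "separable_space (euclidean :: 'h topology)"
    and "d \<in> bounded_ops"
  shows "quasidiagonal d \<longleftrightarrow>
    (\<exists>p P. incseq_finite_rank_projections p \<and>
      (\<forall>n::nat. rota_baxter (-1) (P n) \<and> matches (-1) (P n) (blinfun_apply (p n))) \<and>
      sot_tendsto p id_blinfun \<and>
      (\<forall>b\<in>cstar_alg d. (\<lambda>n. norm (P n b - adj (P n (adj b)))) \<longlonglongrightarrow> 0))"
    (is "_ \<longleftrightarrow> ?rhs")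
proof
  assume "quasidiagonal d"
  then obtain p where p: "incseq_finite_rank_projections p" "sot_tendsto p id_blinfun"
    and lim: "(\<lambda>n. norm (commutator d (p n))) \<longlonglongrightarrow> 0"
    by (auto simp: quasidiagonal_def)
  then have proj: "projection (p n)" for n by (simp add: incseq_finite_rank_projections_def)
  have "(\<lambda>n. norm ((p n o\<^sub>L b) - adj (p n o\<^sub>L adj b))) \<longlonglongrightarrow> 0" if b: "b \<in> cstar_alg d" for b
  proof -
    have "b \<in> bounded_ops" using b cstar_alg_subset_bounded_ops[OF assms(2)] by auto
    then have "(p n o\<^sub>L b) - adj (p n o\<^sub>L adj b) = - commutator b (p n)" for n
      using proj[of n]
      by (simp add: projection_def adj_compose adj_bounded_ops adj_adj commutator_def)
    with commutator_cstar_alg_tendsto_0[OF proj assms(2) lim b] show ?thesis by simp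
  qed
  moreover have "rota_baxter (-1) (\<lambda>a. p n o\<^sub>L a)" "matches (-1) (\<lambda>a. p n o\<^sub>L a) (p n)" for n
    by (rule rota_baxter_left_mult matches_left_mult, rule proj)+
  ultimately show ?rhs
    using p by (intro exI[of _ p] exI[of _ "\<lambda>n a. p n o\<^sub>L a"]) simp
next
  assume ?rhs
  then obtain p P where p: "incseq_finite_rank_projections p" "sot_tendsto p id_blinfun"
    and P: "\<And>n. rota_baxter (-1) (P n)" "\<And>n. matches (-1) (P n) (blinfun_apply (p n))"
    and lim: "\<And>b. b \<in> cstar_alg d \<Longrightarrow> (\<lambda>n. norm (P n b - adj (P n (adj b)))) \<longlonglongrightarrow> 0"
    by blast
  have "d \<in> cstar_alg d"
    unfolding cstar_alg_def using star_alg_gen closure_subset by blast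
  then have lim4: "(\<lambda>n. 4 * norm (P n d - adj (P n (adj d)))) \<longlonglongrightarrow> 0"
    using lim by (intro tendsto_mult_right_zero)
  have "norm (commutator d (p n)) \<le> 4 * norm (P n d - adj (P n (adj d)))" for n
    using p(1) P[of n] assms(2)
    by (intro norm_commutator_le_if_matches)
      (auto simp: incseq_finite_rank_projections_def rota_baxter_def)
  then have "(\<lambda>n. norm (commutator d (p n))) \<longlonglongrightarrow> 0"
    by (intro tendsto_sandwich[OF _ _ tendsto_const lim4]) simp_all
  with p assms(2) show "quasidiagonal d" by (auto simp: quasidiagonal_def)
qed

end
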